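(* Let $R$ be a noetherian domain, $I=(f_1,\ldots,f_n)\neq 0$ an ideal of $R$, $f\in R$, and let $A=R[T_1,\ldots,T_n]/(f_1T_1+\cdots+f_nT_n+f)$ be the forcing algebra for these data. Let $H=V(\mathfrak p)$ be the horizontal component of $\operatorname{Spec} A$ and let $V_j=V(\mathfrak q_j)$, $j\in J$, be the vertical components of $\operatorname{Spec} A$. Let $Z_i=\bigcup_{j\in J_i}V_j$ be the connected components of $\bigcup_{j\in J}V(\mathfrak q_j)$. Then $\operatorname{Spec} A$ is connected if and only if $H$ intersects every $Z_i$.
   Context: The empty topological space is not considered connected. Prime ideals of $R[T_1,\ldots,T_n]$ minimal over $(f_1T_1+\cdots+f_nT_n+f)$ are identified with the minimal prime ideals of $A$. For a noetherian domain $R$ and $I\neq 0$, there is a unique irreducible component $H$ of $\operatorname{Spec} A$ whose image in $\operatorname{Spec} R$ is dense; it is called the horizontal component and is given by the prime ideal $\mathfrak p=R[T_1,\ldots,T_n]\cap (f_1T_1+\cdots+f_nT_n+f)\,Q(R)[T_1,\ldots,T_n]$, where $Q(R)$ is the quotient field of $R$. All other irreducible components of $\operatorname{Spec} A$ are called vertical components; each is of the form $V(\mathfrak q R[T_1,\ldots,T_n])$ (viewed in $\operatorname{Spec} A$) for a prime ideal $\mathfrak q$ of $R$ minimal over $(f_1,\ldots,f_n,f)$, and $V(\mathfrak q_j)$ is shorthand for this closed subset of $\operatorname{Spec} A$. *)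

theory Defs
  imports "HOL-Analysis.Abstract_Topology_2" "HOL-Library.Poly_Mapping"
    "HOL-Algebra.Ring_Divisibility" "HOL-Algebra.Algebraic_Closure_Type"
begin

definition irreducible_space :: "'a topology \<Rightarrow> bool" where
  "irreducible_space T \<longleftrightarrow> topspace T \<noteq> {} \<and>
     (\<forall>C D. closedin T C \<and> closedin T D \<and> C \<union> D = topspace T \<longrightarrow> C = topspace T \<or> D = topspace T)"

definition irreducible_components_of :: "'a topology \<Rightarrow> 'a set set" where
  "irreducible_components_of T =
     {S. S \<subseteq> topspace T \<and> irreducible_space (subtopology T S) \<and>
         (\<forall>S'. S' \<subseteq> topspace T \<and> irreducible_space (subtopology T S') \<and> S \<subseteq> S' \<longrightarrow> S' = S)}"

text \<open>\<^const>\<open>connected_space\<close> counts the empty space as connected; here it is not.\<close>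

definition nonempty_connected_space :: "'a topology \<Rightarrow> bool" where
  "nonempty_connected_space T \<longleftrightarrow> topspace T \<noteq> {} \<and> connected_space T"

definition zero_locus :: "('a, 'b) ring_scheme \<Rightarrow> 'a set \<Rightarrow> 'a set set" where
  "zero_locus R S = {P. primeideal P R \<and> S \<subseteq> P}"

definition Spec :: "('a, 'b) ring_scheme \<Rightarrow> 'a set topology" where
  "Spec R = topology (\<lambda>U. \<exists>S\<subseteq>carrier R. U = {P. primeideal P R} - zero_locus R S)"

lemma istopology_Spec:
  "istopology (\<lambda>U. \<exists>S\<subseteq>carrier R. U = {P. primeideal P R} - zero_locus R S)"
  unfolding istopology_def
proof (intro conjI allI impI)
  fix U V
  assume "\<exists>S\<subseteq>carrier R. U = {P. primeideal P R} - zero_locus R S"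
    and "\<exists>S\<subseteq>carrier R. V = {P. primeideal P R} - zero_locus R S"
  then obtain S T where S: "S \<subseteq> carrier R" "U = {P. primeideal P R} - zero_locus R S"
    and T: "T \<subseteq> carrier R" "V = {P. primeideal P R} - zero_locus R T"
    by blast
  define W where "W = {s \<otimes>\<^bsub>R\<^esub> t | s t. s \<in> S \<and> t \<in> T}"
  have prod: "W \<subseteq> P \<longleftrightarrow> S \<subseteq> P \<or> T \<subseteq> P" if P: "primeideal P R" for P
  proof
    interpret primeideal P R by fact
    show "S \<subseteq> P \<or> T \<subseteq> P" if "W \<subseteq> P"
    proof (rule ccontr)
      assume "\<not> (S \<subseteq> P \<or> T \<subseteq> P)"
      then obtain s t where st: "s \<in> S" "s \<notin> P" "t \<in> T" "t \<notin> P" by blast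
      then have "s \<otimes>\<^bsub>R\<^esub> t \<in> P" using that unfolding W_def by blast
      then show False using I_prime[of s t] S(1) T(1) st by blast
    qed
    show "W \<subseteq> P" if "S \<subseteq> P \<or> T \<subseteq> P"
    proof
      fix w assume "w \<in> W"
      then obtain s t where "w = s \<otimes>\<^bsub>R\<^esub> t" "s \<in> S" "t \<in> T" unfolding W_def by blast
      then show "w \<in> P" using that S(1) T(1) I_l_closed[of t s] I_r_closed[of s t] by blast
    qed
  qed
  show "\<exists>Y\<subseteq>carrier R. U \<inter> V = {P. primeideal P R} - zero_locus R Y"
  proof (cases "\<exists>P. primeideal P R")
    case True
    then interpret cring R unfolding primeideal_def by blast
    have "W \<subseteq> carrier R" using S(1) T(1) unfolding W_def by blast
    moreover have "U \<inter> V = {P. primeideal P R} - zero_locus R W"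
      unfolding S(2) T(2) zero_locus_def using prod by blast
    ultimately show ?thesis by blast
  next
    case False
    then show ?thesis unfolding S(2) by blast
  qed
next
  fix \<U>
  assume "\<forall>U\<in>\<U>. \<exists>S\<subseteq>carrier R. U = {P. primeideal P R} - zero_locus R S"
  then have "\<exists>S. \<forall>U\<in>\<U>. S U \<subseteq> carrier R \<and> U = {P. primeideal P R} - zero_locus R (S U)"
    by (intro bchoice) blast
  then obtain S where
    S: "\<And>U. U \<in> \<U> \<Longrightarrow> S U \<subseteq> carrier R \<and> U = {P. primeideal P R} - zero_locus R (S U)"
    by blast
  have "P \<in> \<Union>\<U> \<longleftrightarrow> P \<in> {P. primeideal P R} - zero_locus R (\<Union>(S ` \<U>))" for P
  proof -
    have "P \<in> U \<longleftrightarrow> primeideal P R \<and> \<not> S U \<subseteq> P" if "U \<in> \<U>" for U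
      using S[OF that] unfolding zero_locus_def by blast
    then show ?thesis unfolding zero_locus_def by blast
  qed
  then have "\<Union>\<U> = {P. primeideal P R} - zero_locus R (\<Union>(S ` \<U>))" by blast
  moreover have "\<Union>(S ` \<U>) \<subseteq> carrier R" using S by blast
  ultimately show "\<exists>Y\<subseteq>carrier R. \<Union>\<U> = {P. primeideal P R} - zero_locus R Y"
    by blast
qed

lemma openin_Spec:
  "openin (Spec R) U \<longleftrightarrow> (\<exists>S\<subseteq>carrier R. U = {P. primeideal P R} - zero_locus R S)"
  unfolding Spec_def by (subst topology_inverse'[OF istopology_Spec]) (rule refl)

lemma topspace_Spec: "topspace (Spec R) = {P. primeideal P R}"
proof
  show "topspace (Spec R) \<subseteq> {P. primeideal P R}"
    unfolding topspace_def openin_Spec by blast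
  have "\<not> carrier R \<subseteq> P" if "primeideal P R" for P
  proof -
    interpret primeideal P R by fact
    show ?thesis using I_notcarr a_subset by blast
  qed
  then have "zero_locus R (carrier R) = {}"
    unfolding zero_locus_def by blast
  then have "openin (Spec R) {P. primeideal P R}"
    unfolding openin_Spec by (intro exI[of _ "carrier R"]) simp
  then show "{P. primeideal P R} \<subseteq> topspace (Spec R)" by (rule openin_subset)
qed

lemma closedin_Spec:
  "closedin (Spec R) C \<longleftrightarrow> (\<exists>S\<subseteq>carrier R. C = zero_locus R S)"
proof -
  have sub: "zero_locus R S \<subseteq> {P. primeideal P R}" for S by (auto simp: zero_locus_def)
  show ?thesis
  proof
    assume "closedin (Spec R) C"
    then obtain S where "C \<subseteq> {P. primeideal P R}" "S \<subseteq> carrier R"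
      "{P. primeideal P R} - C = {P. primeideal P R} - zero_locus R S"
      unfolding closedin_def topspace_Spec openin_Spec by blast
    moreover from this have "C = zero_locus R S" using sub[of S] by blast
    ultimately show "\<exists>S\<subseteq>carrier R. C = zero_locus R S" by blast
  next
    assume "\<exists>S\<subseteq>carrier R. C = zero_locus R S"
    then show "closedin (Spec R) C"
      unfolding closedin_def topspace_Spec openin_Spec using sub by blast
  qed
qed

definition Spec_map :: "('a, 'b) ring_scheme \<Rightarrow> ('a \<Rightarrow> 'c) \<Rightarrow> 'c set \<Rightarrow> 'a set" where
  "Spec_map R \<phi> P = {r \<in> carrier R. \<phi> r \<in> P}"

text \<open>Polynomials in the variables \<open>T\<^sub>i\<close>, with \<open>i\<close> ranging over a type of variables, over a
  coefficient type; exponent vectors are finitely supported functions.\<close>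

type_synonym ('n, 'a) mpoly = "('n \<Rightarrow>\<^sub>0 nat) \<Rightarrow>\<^sub>0 'a"

definition mpoly_const :: "'a::zero \<Rightarrow> ('n, 'a) mpoly" where
  "mpoly_const a = Poly_Mapping.single 0 a"

definition mpoly_var :: "'n \<Rightarrow> ('n, 'a::zero_neq_one) mpoly" where
  "mpoly_var i = Poly_Mapping.single (Poly_Mapping.single i 1) 1"

definition forcing_polynomial ::
    "('n::finite \<Rightarrow> 'a::comm_ring_1) \<Rightarrow> 'a \<Rightarrow> ('n, 'a) mpoly" where
  "forcing_polynomial fs f = (\<Sum>i\<in>UNIV. mpoly_const (fs i) * mpoly_var i) + mpoly_const f"

definition forcing_ideal ::
    "('n::finite \<Rightarrow> 'a::comm_ring_1) \<Rightarrow> 'a \<Rightarrow> ('n, 'a) mpoly set" where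
  "forcing_ideal fs f = Idl\<^bsub>ring_of_type_algebra\<^esub> {forcing_polynomial fs f}"

definition forcing_algebra ::
    "('n::finite \<Rightarrow> 'a::comm_ring_1) \<Rightarrow> 'a \<Rightarrow> ('n, 'a) mpoly set ring" where
  "forcing_algebra fs f = ring_of_type_algebra Quot forcing_ideal fs f"

definition forcing_structure_map ::
    "('n::finite \<Rightarrow> 'a::comm_ring_1) \<Rightarrow> 'a \<Rightarrow> 'a \<Rightarrow> ('n, 'a) mpoly set" where
  "forcing_structure_map fs f r = forcing_ideal fs f +>\<^bsub>ring_of_type_algebra\<^esub> mpoly_const r"

text \<open>For a noetherian domain and a nonzero ideal \<open>(f\<^sub>1, \<dots>, f\<^sub>n)\<close> exactly one irreducible
  component of the spectrum of the forcing algebra has dense image in the spectrum of the base.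
  Writing \<open>g\<close> for the forcing polynomial, it is the zero locus of the contraction to
  \<open>R[T\<^sub>1, \<dots>, T\<^sub>n]\<close> of the ideal generated by \<open>g\<close> over the quotient field.\<close>

definition horizontal_component ::
    "('n::finite \<Rightarrow> 'a::comm_ring_1) \<Rightarrow> 'a \<Rightarrow> ('n, 'a) mpoly set set set" where
  "horizontal_component fs f =
     (THE H. H \<in> irreducible_components_of (Spec (forcing_algebra fs f)) \<and>
        Spec (ring_of_type_algebra :: 'a ring) closure_of
          (Spec_map ring_of_type_algebra (forcing_structure_map fs f) ` H)
        = topspace (Spec (ring_of_type_algebra :: 'a ring)))"

definition vertical_components ::
    "('n::finite \<Rightarrow> 'a::comm_ring_1) \<Rightarrow> 'a \<Rightarrow> ('n, 'a) mpoly set set set set" where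
  "vertical_components fs f =
     irreducible_components_of (Spec (forcing_algebra fs f)) - {horizontal_component fs f}"

end

theory Submission
  imports Defs
begin

text \<open>Write \<open>R\<close> for the base ring, \<open>g = f\<^sub>1 T\<^sub>1 + \<dots> + f\<^sub>n T\<^sub>n + f\<close> for the forcing polynomial and \<open>A\<close> for
  the forcing algebra.

  Once \<open>Spec A\<close> is known to be the union of \<open>H\<close> and finitely many other irreducible closed
  sets, the statement is pure topology. If \<open>H\<close> meets every connected component \<open>Z\<close> of the
  vertical part, all these components are tied together by the connected set \<open>H\<close>. If some \<open>Z\<close> misses
  \<open>H\<close>, then \<open>Z\<close> and the union of \<open>H\<close> with the rest of the vertical part are disjoint nonempty closed
  sets covering \<open>Spec A\<close>; here finiteness enters. This is \<open>connected_space_iff_meets_components\<close>.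

  The cover comes from a dichotomy for a prime \<open>P\<close> of \<open>R[T\<^sub>1, \<dots>, T\<^sub>n]\<close> containing \<open>g\<close>. If \<open>P\<close> avoids
  some \<open>f\<^sub>j\<close>, then \<open>P\<close> contains the horizontal ideal \<open>p = {h. d h \<in> (g) for some d \<noteq> 0 in R}\<close>
  (\<open>horizontal_ideal_subset_prime\<close>). If \<open>P\<close> contains every \<open>f\<^sub>j\<close>, it also contains \<open>f\<close>, hence one of
  finitely many primes \<open>q\<close> of the noetherian ring \<open>R\<close> over \<open>(f\<^sub>1, \<dots>, f\<^sub>n, f)\<close>
  (\<open>finitely_many_primes_below_all\<close>), together with \<open>q R[T\<^sub>1, \<dots>, T\<^sub>n]\<close>. The sets \<open>V(p)\<close> and
  \<open>V(q R[T\<^sub>1, \<dots>, T\<^sub>n])\<close> therefore cover \<open>Spec A\<close>, and they are irreducible because the ideals are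
  prime. For \<open>q R[T\<^sub>1, \<dots>, T\<^sub>n]\<close> this is seen on leading monomials (\<open>primeideal_coeff_extension\<close>).
  For \<open>p\<close> one uses that \<open>g\<close> is linear in a variable \<open>T\<^sub>i\<close> with \<open>f\<^sub>i \<noteq> 0\<close>: up to powers of \<open>f\<^sub>i\<close>, the
  variable \<open>T\<^sub>i\<close> can be eliminated modulo \<open>g\<close> (\<open>pseudo_division_by_forcing_polynomial\<close>), and no nonzero
  multiple of \<open>g\<close> is free of \<open>T\<^sub>i\<close> (\<open>free_of_multiple_of_forcing_polynomial\<close>).

  Finally \<open>p \<inter> R = 0\<close>, whereas \<open>q R[T\<^sub>1, \<dots>, T\<^sub>n] \<inter> R\<close> contains \<open>f\<^sub>i\<close>. So \<open>V(p)\<close> is the only member of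
  the cover with dense image in \<open>Spec R\<close>, and it is the horizontal component.\<close>

section \<open>Finite covers by irreducible closed sets\<close>

lemma irreducible_space_subtopology_iff:
  assumes "S \<subseteq> topspace T"
  shows "irreducible_space (subtopology T S) \<longleftrightarrow>
    S \<noteq> {} \<and> (\<forall>C D. closedin T C \<and> closedin T D \<and> S \<subseteq> C \<union> D \<longrightarrow> S \<subseteq> C \<or> S \<subseteq> D)"
  (is "?L \<longleftrightarrow> ?R")
proof -
  have top: "topspace (subtopology T S) = S" using assms by auto
  show ?thesis
  proof
    assume L: ?L
    show ?R
    proof (intro conjI allI impI)
      show "S \<noteq> {}" using L top by (simp add: irreducible_space_def)
      fix C D assume *: "closedin T C \<and> closedin T D \<and> S \<subseteq> C \<union> D"
      then have "closedin (subtopology T S) (C \<inter> S)" "closedin (subtopology T S) (D \<inter> S)"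
        by (auto simp: closedin_subtopology)
      moreover have "(C \<inter> S) \<union> (D \<inter> S) = S" using * by blast
      ultimately show "S \<subseteq> C \<or> S \<subseteq> D"
        using L top unfolding irreducible_space_def by (metis inf.orderI inf_commute)
    qed
  next
    assume R: ?R
    show ?L unfolding irreducible_space_def top
    proof (intro conjI allI impI)
      show "S \<noteq> {}" using R by blast
      fix C D
      assume *: "closedin (subtopology T S) C \<and> closedin (subtopology T S) D \<and> C \<union> D = S"
      then obtain C' D' where "closedin T C'" "C = C' \<inter> S" "closedin T D'" "D = D' \<inter> S"
        by (auto simp: closedin_subtopology)
      then show "C = S \<or> D = S" using R * by blast
    qed
  qed
qed

lemma irreducible_imp_connectedin:
  assumes "S \<subseteq> topspace T" "irreducible_space (subtopology T S)"
  shows "connectedin T S"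
  using assms unfolding connectedin_closedin irreducible_space_subtopology_iff[OF assms(1)]
  by blast

lemma irreducible_subset_finite_Union:
  assumes "S \<subseteq> topspace T" "irreducible_space (subtopology T S)"
    and "finite \<F>" "\<And>C. C \<in> \<F> \<Longrightarrow> closedin T C" "S \<subseteq> \<Union>\<F>"
  shows "\<exists>C\<in>\<F>. S \<subseteq> C"
  using assms(3-)
proof (induction \<F>)
  case empty
  then show ?case using assms(2) irreducible_space_subtopology_iff[OF assms(1)] by auto
next
  case (insert C \<F>)
  have "closedin T (\<Union>\<F>)" using insert by (intro closedin_Union) auto
  moreover have "closedin T C" "S \<subseteq> C \<union> \<Union>\<F>" using insert.prems by auto
  ultimately have "S \<subseteq> C \<or> S \<subseteq> \<Union>\<F>"
    using assms(2) irreducible_space_subtopology_iff[OF assms(1)] by blast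
  then show ?case using insert.IH insert.prems by blast
qed

text \<open>A member of the cover that lies in no other member is maximal among all irreducible
  subsets, because each of those lies in some member of the cover.\<close>

lemma irreducible_components_of_finite_cover:
  assumes fin: "finite \<F>"
    and F: "\<And>C. C \<in> \<F> \<Longrightarrow> closedin T C \<and> irreducible_space (subtopology T C)"
    and cov: "\<Union>\<F> = topspace T"
  shows "irreducible_components_of T = {C \<in> \<F>. \<forall>D\<in>\<F>. C \<subseteq> D \<longrightarrow> D = C}"
proof -
  have sub: "\<exists>C\<in>\<F>. S \<subseteq> C"
    if "S \<subseteq> topspace T" "irreducible_space (subtopology T S)" for S
    by (rule irreducible_subset_finite_Union[OF that fin]) (use F cov that(1) in auto)
  have irr: "C \<subseteq> topspace T \<and> irreducible_space (subtopology T C)" if "C \<in> \<F>" for C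
    using that cov F[OF that] by auto
  show ?thesis
  proof (intro equalityI subsetI)
    fix S assume "S \<in> irreducible_components_of T"
    then have S: "S \<subseteq> topspace T" "irreducible_space (subtopology T S)"
      and max: "\<And>S'. S' \<subseteq> topspace T \<and> irreducible_space (subtopology T S') \<Longrightarrow> S \<subseteq> S' \<Longrightarrow> S' = S"
      unfolding irreducible_components_of_def by simp_all
    obtain C where C: "C \<in> \<F>" "S \<subseteq> C" using sub[OF S] by (rule bexE)
    then have "C = S" using max irr by simp
    moreover have "\<forall>D\<in>\<F>. S \<subseteq> D \<longrightarrow> D = S" using max irr by simp
    ultimately show "S \<in> {C \<in> \<F>. \<forall>D\<in>\<F>. C \<subseteq> D \<longrightarrow> D = C}" using C(1) by simp
  next
    fix C assume "C \<in> {C \<in> \<F>. \<forall>D\<in>\<F>. C \<subseteq> D \<longrightarrow> D = C}"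
    then have C: "C \<in> \<F>" and max: "\<And>D. D \<in> \<F> \<Longrightarrow> C \<subseteq> D \<Longrightarrow> D = C" by simp_all
    have "S = C" if S: "S \<subseteq> topspace T" "irreducible_space (subtopology T S)" "C \<subseteq> S" for S
    proof -
      obtain D where D: "D \<in> \<F>" "S \<subseteq> D" using sub[OF S(1,2)] by (rule bexE)
      then have "D = C" using max[of D] S(3) by simp
      then show ?thesis using D(2) S(3) by simp
    qed
    then show "C \<in> irreducible_components_of T"
      using irr[OF C] unfolding irreducible_components_of_def by simp
  qed
qed

lemma Union_irreducible_components_of_finite_cover:
  assumes fin: "finite \<F>"
    and F: "\<And>C. C \<in> \<F> \<Longrightarrow> closedin T C \<and> irreducible_space (subtopology T C)"
    and cov: "\<Union>\<F> = topspace T"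
  shows "\<Union>(irreducible_components_of T) = topspace T"
proof -
  have "\<exists>D \<in> irreducible_components_of T. x \<in> D" if x: "x \<in> topspace T" for x
  proof -
    obtain C where C: "C \<in> \<F>" "x \<in> C" using x cov by blast
    then obtain M where "M \<in> \<F>" "C \<subseteq> M" "\<forall>D\<in>\<F>. M \<subseteq> D \<longrightarrow> D = M"
      using finite_has_maximal2[OF fin C(1)] by metis
    then show ?thesis
      using C irreducible_components_of_finite_cover[OF assms] by blast
  qed
  moreover have "\<Union>(irreducible_components_of T) \<subseteq> topspace T"
    unfolding irreducible_components_of_def by blast
  ultimately show ?thesis by blast
qed

text \<open>The topological core. If \<open>H\<close> meets every component of \<open>\<Union>\<V>\<close>, all of these hang together
  through \<open>H\<close>. Conversely, a component \<open>Z\<close> of \<open>\<Union>\<V>\<close> is a union of members of \<open>\<V>\<close>, so \<open>Z\<close> and the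
  union of the remaining members are both closed by finiteness; if \<open>Z\<close> misses \<open>H\<close>, it splits
  off from the whole space.\<close>

lemma connected_space_iff_meets_components:
  assumes H: "closedin T H" "connectedin T H" "H \<noteq> {}"
    and fin: "finite \<V>"
    and V: "\<And>C. C \<in> \<V> \<Longrightarrow> closedin T C \<and> connectedin T C"
    and cov: "H \<union> \<Union>\<V> = topspace T"
  shows "connected_space T \<longleftrightarrow>
    (\<forall>Z \<in> connected_components_of (subtopology T (\<Union>\<V>)). H \<inter> Z \<noteq> {})"
proof -
  let ?Y = "subtopology T (\<Union>\<V>)"
  have top: "topspace ?Y = \<Union>\<V>" using cov by auto
  have cl: "closedin T (\<Union>\<V>)" using fin V by (intro closedin_Union) auto
  show ?thesis
  proof (intro iffI ballI notI)
    fix Z assume T: "connected_space T" and Z: "Z \<in> connected_components_of ?Y" and "H \<inter> Z = {}"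
    define W where "W = H \<union> \<Union>{C \<in> \<V>. \<not> C \<subseteq> Z}"
    have dich: "C \<subseteq> Z \<or> C \<inter> Z = {}" if "C \<in> \<V>" for C
    proof -
      have "connectedin ?Y C"
        using V[OF that] that by (auto simp: connectedin_subtopology)
      then show ?thesis
        using connected_components_of_maximal[OF Z] by (auto simp: disjnt_def)
    qed
    have "Z \<subseteq> \<Union>\<V>" using connected_components_of_subset[OF Z] top by simp
    then have un: "topspace T \<subseteq> Z \<union> W"
      using cov unfolding W_def by blast
    moreover have "Z \<inter> W = {}" using dich \<open>H \<inter> Z = {}\<close> unfolding W_def by blast
    moreover have "closedin T Z"
      using closedin_trans_full[OF closedin_connected_components_of[OF Z] cl] .
    moreover have "closedin T W"
      unfolding W_def using fin V H by (intro closedin_Un closedin_Union) auto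
    moreover have "Z \<noteq> {}" "W \<noteq> {}"
      using nonempty_connected_components_of[OF Z] H(3) unfolding W_def by auto
    ultimately show False
      using T unfolding connected_space_closedin by blast
  next
    assume R: "\<forall>Z \<in> connected_components_of ?Y. H \<inter> Z \<noteq> {}"
    let ?F = "insert H ((\<lambda>Z. H \<union> Z) ` connected_components_of ?Y)"
    have "connectedin T (\<Union>?F)"
    proof (rule connectedin_Union)
      fix S assume "S \<in> ?F"
      moreover have "connectedin T (H \<union> Z)" if "Z \<in> connected_components_of ?Y" for Z
        using connectedin_Un[OF H(2)] R that connectedin_connected_components_of[OF that]
        by (auto simp: connectedin_subtopology)
      ultimately show "connectedin T S" using H(2) by blast
    next
      show "\<Inter>?F \<noteq> {}" using H(3) by blast
    qed
    moreover have "\<Union>?F = topspace T"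
    proof -
      have "\<Union>?F = H \<union> \<Union>(connected_components_of ?Y)" by blast
      then show ?thesis unfolding Union_connected_components_of top cov .
    qed
    ultimately show "connected_space T" by (simp add: connectedin_topspace)
  qed
qed

section \<open>Prime ideals\<close>

text \<open>Noetherian induction on the ideal generated by \<open>S\<close>: an ideal \<open>I\<close> that is maximal among the
  counterexamples is proper and not prime, so \<open>a b \<in> I\<close> for some \<open>a, b\<close> outside \<open>I\<close>. Every prime over
  \<open>I\<close> then contains \<open>I + (a)\<close> or \<open>I + (b)\<close>, and the finite sets belonging to these two larger
  ideals together serve for \<open>I\<close>.\<close>

lemma (in noetherian_ring) finitely_many_primes_below_all:
  assumes "cring R" "S \<subseteq> carrier R"
  obtains Q where "finite Q" "\<And>q. q \<in> Q \<Longrightarrow> primeideal q R \<and> S \<subseteq> q"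
    "\<And>P. primeideal P R \<Longrightarrow> S \<subseteq> P \<Longrightarrow> \<exists>q\<in>Q. q \<subseteq> P"
proof -
  define good where "good I \<longleftrightarrow> (\<exists>Q. finite Q \<and> (\<forall>q\<in>Q. primeideal q R \<and> I \<subseteq> q) \<and>
      (\<forall>P. primeideal P R \<longrightarrow> I \<subseteq> P \<longrightarrow> (\<exists>q\<in>Q. q \<subseteq> P)))" for I
  define B where "B = {I. ideal I R \<and> \<not> good I}"
  have step: "good I" if I: "ideal I R" and bigger: "\<And>K. ideal K R \<Longrightarrow> I \<subset> K \<Longrightarrow> good K" for I
  proof -
    interpret I: ideal I R by fact
    consider "primeideal I R" | "carrier R = I"
      | a b where "a \<in> carrier R" "b \<in> carrier R" "a \<otimes> b \<in> I" "a \<notin> I" "b \<notin> I"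
      using I.primeidealCD[OF assms(1)] by blast
    then show "good I"
    proof cases
      case 1
      then show ?thesis unfolding good_def by (intro exI[of _ "{I}"]) auto
    next
      case 2
      have "\<not> I \<subseteq> P" if "primeideal P R" for P
      proof -
        interpret P: primeideal P R by fact
        show ?thesis using P.I_notcarr P.a_subset 2 by blast
      qed
      then show ?thesis unfolding good_def by (intro exI[of _ "{}"]) auto
    next
      case 3
      have ins: "insert a I \<subseteq> carrier R" "insert b I \<subseteq> carrier R"
        using 3 I.a_subset by auto
      have gen: "good (Idl (insert c I))" if "insert c I \<subseteq> carrier R" "c \<notin> I" for c
        using bigger[OF genideal_ideal[OF that(1)]] genideal_self[OF that(1)] that(2) by blast
      obtain Qa where Qa: "finite Qa" "\<forall>q\<in>Qa. primeideal q R \<and> Idl (insert a I) \<subseteq> q"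
        "\<forall>P. primeideal P R \<longrightarrow> Idl (insert a I) \<subseteq> P \<longrightarrow> (\<exists>q\<in>Qa. q \<subseteq> P)"
        using gen[OF ins(1) 3(4)] unfolding good_def by blast
      obtain Qb where Qb: "finite Qb" "\<forall>q\<in>Qb. primeideal q R \<and> Idl (insert b I) \<subseteq> q"
        "\<forall>P. primeideal P R \<longrightarrow> Idl (insert b I) \<subseteq> P \<longrightarrow> (\<exists>q\<in>Qb. q \<subseteq> P)"
        using gen[OF ins(2) 3(5)] unfolding good_def by blast
      have "\<exists>q\<in>Qa \<union> Qb. q \<subseteq> P" if P: "primeideal P R" "I \<subseteq> P" for P
      proof -
        have "a \<in> P \<or> b \<in> P" using primeideal.I_prime[OF P(1) 3(1,2)] 3(3) P(2) by blast
        then have "Idl (insert a I) \<subseteq> P \<or> Idl (insert b I) \<subseteq> P"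
          using genideal_minimal[OF primeideal.axioms(1)[OF P(1)]] P(2) by blast
        then show ?thesis using Qa(3) Qb(3) P(1) by blast
      qed
      moreover have "I \<subseteq> q" if "q \<in> Qa \<union> Qb" for q
      proof -
        have "Idl (insert a I) \<subseteq> q \<or> Idl (insert b I) \<subseteq> q" using that Qa(2) Qb(2) by auto
        moreover have "I \<subseteq> Idl (insert a I)" "I \<subseteq> Idl (insert b I)"
          using genideal_self[OF ins(1)] genideal_self[OF ins(2)] by simp_all
        ultimately show ?thesis by (elim disjE) simp_all
      qed
      moreover have "finite (Qa \<union> Qb)" "\<And>q. q \<in> Qa \<union> Qb \<Longrightarrow> primeideal q R"
        using Qa(1,2) Qb(1,2) by auto
      ultimately show ?thesis
        unfolding good_def by (intro exI[of _ "Qa \<union> Qb"] conjI ballI allI impI)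
    qed
  qed
  have "B = {}"
  proof (rule ccontr)
    assume ne: "B \<noteq> {}"
    have "\<exists>M\<in>B. \<forall>I\<in>B. M \<subseteq> I \<longrightarrow> I = M"
    proof (rule subset_Zorn_nonempty[OF ne])
      fix \<C> assume C: "\<C> \<noteq> {}" "subset.chain B \<C>"
      then have "subset.chain {I. ideal I R} \<C>"
        unfolding B_def pred_on.chain_def by blast
      then have "\<Union>\<C> \<in> \<C>" using ideal_chain_is_trivial C(1) by blast
      then show "\<Union>\<C> \<in> B" using C(2) unfolding pred_on.chain_def by blast
    qed
    then obtain M where M: "M \<in> B" "\<And>I. I \<in> B \<Longrightarrow> M \<subseteq> I \<Longrightarrow> I = M" by blast
    then have "good M" using step[of M] unfolding B_def by blast
    then show False using M(1) unfolding B_def by blast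
  qed
  then have "good (Idl S)" using genideal_ideal[OF assms(2)] unfolding B_def by blast
  then obtain Q where Q: "finite Q" "\<forall>q\<in>Q. primeideal q R \<and> Idl S \<subseteq> q"
    "\<forall>P. primeideal P R \<longrightarrow> Idl S \<subseteq> P \<longrightarrow> (\<exists>q\<in>Q. q \<subseteq> P)"
    unfolding good_def by blast
  show thesis
  proof (rule that[OF Q(1)])
    show "primeideal q R \<and> S \<subseteq> q" if "q \<in> Q" for q
      using Q(2) that genideal_self[OF assms(2)] by blast
    show "\<exists>q\<in>Q. q \<subseteq> P" if P: "primeideal P R" "S \<subseteq> P" for P
      using Q(3) P genideal_minimal[OF primeideal.axioms(1)[OF P(1)] P(2)] by blast
  qed
qed

text \<open>\<open>P\<close> is a generic point of its zero locus: a closed set containing \<open>P\<close> contains all of it.\<close>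

lemma irreducible_zero_locus_prime:
  assumes P: "primeideal P R"
  shows "irreducible_space (subtopology (Spec R) (zero_locus R P))"
proof -
  have "zero_locus R P \<subseteq> topspace (Spec R)" by (auto simp: zero_locus_def topspace_Spec)
  moreover have "P \<in> zero_locus R P" using P by (auto simp: zero_locus_def)
  moreover have "zero_locus R P \<subseteq> C" if "closedin (Spec R) C" "P \<in> C" for C
    using that unfolding closedin_Spec zero_locus_def by blast
  ultimately show ?thesis by (subst irreducible_space_subtopology_iff) blast+
qed

lemma (in ideal) rcos_in_image_iff:
  assumes K: "ideal K R" "I \<subseteq> K" and x: "x \<in> carrier R"
  shows "I +> x \<in> (+>) I ` K \<longleftrightarrow> x \<in> K"
proof
  interpret K: ideal K R by fact
  assume "I +> x \<in> (+>) I ` K"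
  then obtain k where k: "k \<in> K" "I +> x = I +> k" by blast
  then have "k \<in> carrier R" using K.a_subset by blast
  then have "x \<ominus> k \<in> I" using quotient_eq_iff_same_a_r_cos[OF is_ideal x, of k] k(2) by blast
  then have "(x \<ominus> k) \<oplus> k \<in> K" using K(2) k(1) K.a_closed by blast
  moreover have "(x \<ominus> k) \<oplus> k = x" using x \<open>k \<in> carrier R\<close> by algebra
  ultimately show "x \<in> K" by simp
qed auto

lemma (in ideal) rcos_image_prime:
  assumes "primeideal P R" "I \<subseteq> P"
  shows "primeideal ((+>) I ` P) (R Quot I)"
proof -
  interpret P: primeideal P R by fact
  interpret h: ring_hom_ring R "R Quot I" "(+>) I" by (rule rcos_ring_hom_ring)
  have surj: "\<exists>x\<in>carrier R. Y = I +> x" if "Y \<in> carrier (R Quot I)" for Y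
    using that unfolding FactRing_def A_RCOSETS_def' by auto
  note mem = rcos_in_image_iff[OF P.is_ideal assms(2)]
  show ?thesis
  proof (rule primeidealI)
    show "ideal ((+>) I ` P) (R Quot I)"
      by (rule ring_ideal_imp_quot_ideal[OF is_ideal P.is_ideal])
    show "cring (R Quot I)" by (rule quotient_is_cring[OF P.is_cring])
    show "carrier (R Quot I) \<noteq> (+>) I ` P"
    proof
      assume *: "carrier (R Quot I) = (+>) I ` P"
      have "I +> \<one> \<in> (+>) I ` P" using h.hom_closed[OF one_closed] * by simp
      then show False using mem[OF one_closed] P.one_imp_carrier P.I_notcarr by blast
    qed
    fix A B
    assume AB: "A \<in> carrier (R Quot I)" "B \<in> carrier (R Quot I)"
      and "A \<otimes>\<^bsub>R Quot I\<^esub> B \<in> (+>) I ` P"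
    moreover obtain a b where ab: "a \<in> carrier R" "A = I +> a" "b \<in> carrier R" "B = I +> b"
      using surj AB by meson
    ultimately have "I +> (a \<otimes> b) \<in> (+>) I ` P" by simp
    then have "a \<in> P \<or> b \<in> P" using mem ab P.I_prime by blast
    then show "A \<in> (+>) I ` P \<or> B \<in> (+>) I ` P" using ab by blast
  qed
qed

section \<open>Ideals in the ring of a type class\<close>

lemma ring_of_type_algebra_simps [simp]:
  "carrier (ring_of_type_algebra :: 'a::comm_ring_1 ring) = UNIV"
  "a \<otimes>\<^bsub>(ring_of_type_algebra :: 'a::comm_ring_1 ring)\<^esub> b = a * b"
  "a \<oplus>\<^bsub>(ring_of_type_algebra :: 'a::comm_ring_1 ring)\<^esub> b = a + b"
  "\<one>\<^bsub>(ring_of_type_algebra :: 'a::comm_ring_1 ring)\<^esub> = 1"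
  "\<zero>\<^bsub>(ring_of_type_algebra :: 'a::comm_ring_1 ring)\<^esub> = 0"
  by (simp_all add: ring_of_type_algebra_def)

lemma ideal_ring_of_type_algebra_iff:
  fixes I :: "'a::comm_ring_1 set"
  shows "ideal I ring_of_type_algebra \<longleftrightarrow>
    0 \<in> I \<and> (\<forall>a\<in>I. \<forall>b\<in>I. a + b \<in> I) \<and> (\<forall>r. \<forall>a\<in>I. r * a \<in> I)"
proof
  let ?R = "ring_of_type_algebra :: 'a ring"
  assume "ideal I ?R"
  then interpret ideal I ?R .
  show "0 \<in> I \<and> (\<forall>a\<in>I. \<forall>b\<in>I. a + b \<in> I) \<and> (\<forall>r. \<forall>a\<in>I. r * a \<in> I)"
    using I_l_closed additive_subgroup.zero_closed[OF is_additive_subgroup]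
      additive_subgroup.a_closed[OF is_additive_subgroup] by simp
next
  let ?R = "ring_of_type_algebra :: 'a ring"
  interpret R: cring ?R by (rule cring_from_type_algebra)
  assume *: "0 \<in> I \<and> (\<forall>a\<in>I. \<forall>b\<in>I. a + b \<in> I) \<and> (\<forall>r. \<forall>a\<in>I. r * a \<in> I)"
  have "\<ominus>\<^bsub>?R\<^esub> a = - a" for a by (rule R.minus_equality) simp_all
  then have "\<ominus>\<^bsub>?R\<^esub> a \<in> I" if "a \<in> I" for a using that * by (metis mult_minus1)
  then have "subgroup I (add_monoid ?R)"
    using * by (intro R.add.subgroupI) (auto simp: a_inv_def)
  then show "ideal I ?R"
  proof (rule idealI[OF R.ring_axioms])
    fix a x assume "a \<in> I"
    then show "x \<otimes>\<^bsub>?R\<^esub> a \<in> I" "a \<otimes>\<^bsub>?R\<^esub> x \<in> I"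
      using * by (simp_all add: mult.commute[of a x])
  qed
qed

lemma primeideal_ring_of_type_algebra_iff:
  fixes I :: "'a::comm_ring_1 set"
  shows "primeideal I ring_of_type_algebra \<longleftrightarrow>
    ideal I ring_of_type_algebra \<and> 1 \<notin> I \<and> (\<forall>a b. a * b \<in> I \<longrightarrow> a \<in> I \<or> b \<in> I)"
proof
  let ?R = "ring_of_type_algebra :: 'a ring"
  assume "primeideal I ?R"
  then interpret primeideal I ?R .
  show "ideal I ?R \<and> 1 \<notin> I \<and> (\<forall>a b. a * b \<in> I \<longrightarrow> a \<in> I \<or> b \<in> I)"
    using is_ideal one_imp_carrier I_notcarr I_prime by auto
next
  let ?R = "ring_of_type_algebra :: 'a ring"
  assume *: "ideal I ?R \<and> 1 \<notin> I \<and> (\<forall>a b. a * b \<in> I \<longrightarrow> a \<in> I \<or> b \<in> I)"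
  then show "primeideal I ?R"
    by (intro primeidealI cring_from_type_algebra) auto
qed

lemma genideal_singleton_ring_of_type_algebra:
  "Idl\<^bsub>ring_of_type_algebra\<^esub> {g :: 'a::comm_ring_1} = {u * g | u. True}"
proof -
  interpret R: cring "ring_of_type_algebra :: 'a ring" by (rule cring_from_type_algebra)
  show ?thesis
    using R.cgenideal_eq_genideal[of g] by (simp add: cgenideal_def)
qed

lemma ideal_sum_closed:
  fixes I :: "'a::comm_ring_1 set"
  assumes "ideal I ring_of_type_algebra" "\<And>x. x \<in> A \<Longrightarrow> h x \<in> I"
  shows "sum h A \<in> I"
  using assms unfolding ideal_ring_of_type_algebra_iff
  by (induction A rule: infinite_finite_induct) auto

section \<open>Coefficients of polynomials in several variables\<close>

abbreviation lookup :: "('m \<Rightarrow>\<^sub>0 'a::zero) \<Rightarrow> 'm \<Rightarrow> 'a" where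
  "lookup \<equiv> Poly_Mapping.lookup"

abbreviation keys :: "('m \<Rightarrow>\<^sub>0 'a::zero) \<Rightarrow> 'm set" where
  "keys \<equiv> Poly_Mapping.keys"

lemma lookup_mult_keys:
  fixes g h :: "'m::monoid_add \<Rightarrow>\<^sub>0 'a::semiring_0"
  shows "lookup (g * h) k =
    (\<Sum>(a, b) \<in> keys g \<times> keys h. (lookup g a * lookup h b when a + b = k))"
proof -
  have "lookup (g * h) k = prod_fun (lookup g) (lookup h) k"
    by (simp add: lookup_mult prod_fun_def)
  also have "\<dots> = (\<Sum>(a, b). lookup g a * lookup h b when k = a + b)"
    by (rule prod_fun_unfold_prod) auto
  also have "\<dots> = (\<Sum>(a, b) \<in> keys g \<times> keys h. (lookup g a * lookup h b when k = a + b))"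
    by (rule Sum_any.expand_superset) (auto simp: in_keys_iff when_def split: if_splits)
  finally show ?thesis by (simp add: eq_commute[of k])
qed

lemma lookup_const_mult:
  fixes h :: "('n, 'a::comm_ring_1) mpoly"
  shows "lookup (mpoly_const c * h) m = c * lookup h m"
proof -
  have "mpoly_const c * h = Poly_Mapping.map ((*) c) h"
    by (simp add: mpoly_const_def mult_map_scale_conv_mult)
  then show ?thesis by (simp add: Poly_Mapping.map.rep_eq when_def)
qed

lemma lookup_const: "lookup (mpoly_const c) m = (if m = 0 then c else 0)"
  by (auto simp: mpoly_const_def lookup_single when_def)

lemma mpoly_const_0 [simp]: "mpoly_const 0 = 0"
  by (simp add: mpoly_const_def)

lemma mpoly_const_1 [simp]: "mpoly_const 1 = 1"
  by (simp add: mpoly_const_def)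

lemma mpoly_const_add: "mpoly_const (a + b) = mpoly_const a + mpoly_const b"
  by (simp add: mpoly_const_def single_add)

lemma mpoly_const_mult:
  fixes a b :: "'a::comm_ring_1"
  shows "(mpoly_const (a * b) :: ('n, 'a) mpoly) = mpoly_const a * mpoly_const b"
  by (simp add: mpoly_const_def mult_single)

lemma mpoly_const_eq_0_iff [simp]: "(mpoly_const c :: ('n, 'a::zero) mpoly) = 0 \<longleftrightarrow> c = 0"
proof
  assume "(mpoly_const c :: ('n, 'a) mpoly) = 0"
  then have "lookup (mpoly_const c :: ('n, 'a) mpoly) 0 = 0" by simp
  then show "c = 0" by (simp add: lookup_const)
qed simp

text \<open>For an ideal \<open>q\<close> this is the extended ideal \<open>q R[T\<^sub>1, \<dots>, T\<^sub>n]\<close>.\<close>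

definition coeff_extension :: "'a::zero set \<Rightarrow> ('n, 'a) mpoly set" where
  "coeff_extension q = {h. \<forall>m. lookup h m \<in> q}"

lemma ideal_coeff_extension:
  fixes q :: "'a::comm_ring_1 set"
  assumes q: "ideal q ring_of_type_algebra"
  shows "ideal (coeff_extension q :: ('n, 'a) mpoly set) ring_of_type_algebra"
proof -
  have "lookup (r * h) k \<in> q" if "\<forall>m. lookup h m \<in> q" for r h :: "('n, 'a) mpoly" and k
    unfolding lookup_mult_keys using q that
    by (intro ideal_sum_closed) (auto simp: when_def ideal_ring_of_type_algebra_iff)
  then show ?thesis
    using q unfolding ideal_ring_of_type_algebra_iff coeff_extension_def
    by (auto simp: lookup_add)
qed

lemma coeff_extension_subset:
  fixes P :: "('n, 'a::comm_ring_1) mpoly set"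
  assumes P: "ideal P ring_of_type_algebra" and q: "\<And>c. c \<in> q \<Longrightarrow> mpoly_const c \<in> P"
  shows "coeff_extension q \<subseteq> P"
proof
  fix h :: "('n, 'a) mpoly" assume h: "h \<in> coeff_extension q"
  have mono: "Poly_Mapping.single m (lookup h m) \<in> P" for m
  proof -
    have "Poly_Mapping.single m 1 * mpoly_const (lookup h m) \<in> P"
      using P q h unfolding ideal_ring_of_type_algebra_iff coeff_extension_def by blast
    then show ?thesis by (simp add: mpoly_const_def mult_single)
  qed
  have "h = (\<Sum>m\<in>keys h. Poly_Mapping.single m (lookup h m))"
    by (rule poly_mapping_eqI) (simp add: lookup_sum lookup_single when_def in_keys_iff)
  also have "\<dots> \<in> P" using mono by (rule ideal_sum_closed[OF P])
  finally show "h \<in> P" .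
qed

text \<open>Monomials in finitely many variables embed additively into the monomials in variables
  indexed by natural numbers, which carry a linear order compatible with addition.\<close>

definition monomial_code :: "('n::finite \<Rightarrow>\<^sub>0 nat) \<Rightarrow> (nat \<Rightarrow>\<^sub>0 nat)" where
  "monomial_code m = (\<Sum>i\<in>UNIV. Poly_Mapping.single (to_nat_on UNIV i) (lookup m i))"

lemma monomial_code_add: "monomial_code (m + m') = monomial_code m + monomial_code m'"
  by (simp add: monomial_code_def lookup_add single_add sum.distrib)

lemma lookup_monomial_code: "lookup (monomial_code m) (to_nat_on UNIV i) = lookup m i"
  for i :: "'n::finite"
proof -
  have "inj (to_nat_on (UNIV :: 'n set))" 
    by (rule inj_on_to_nat_on) (simp add: countable_finite)
  then have "lookup (monomial_code m) (to_nat_on UNIV i)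
      = (\<Sum>j\<in>UNIV. if j = i then lookup m j else 0)"
    unfolding monomial_code_def lookup_sum
    by (intro sum.cong) (auto simp: lookup_single when_def inj_eq)
  then show ?thesis by simp
qed

lemma monomial_code_eq_iff: "monomial_code m = monomial_code m' \<longleftrightarrow> m = m'"
proof
  assume "monomial_code m = monomial_code m'"
  then have "lookup m i = lookup m' i" for i
    unfolding lookup_monomial_code[symmetric] by simp
  then show "m = m'" by (rule poly_mapping_eqI)
qed simp

lemma obtain_leading_monomial:
  fixes h :: "('n::finite, 'a::comm_ring_1) mpoly"
  assumes "h \<notin> coeff_extension q" "0 \<in> q"
  obtains m where "lookup h m \<notin> q"
    "\<And>a. lookup h a \<notin> q \<Longrightarrow> monomial_code a \<le> monomial_code m"
proof -
  let ?A = "{m \<in> keys h. lookup h m \<notin> q}"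
  have keys: "m \<in> ?A \<longleftrightarrow> lookup h m \<notin> q" for m
    using assms(2) by (auto simp: in_keys_iff)
  then have "?A \<noteq> {}" using assms(1) by (auto simp: coeff_extension_def)
  then have "Max (monomial_code ` ?A) \<in> monomial_code ` ?A" by (intro Max_in) auto
  then obtain m where m: "m \<in> ?A" "Max (monomial_code ` ?A) = monomial_code m" by auto
  show thesis
  proof (rule that)
    show "lookup h m \<notin> q" using m keys by blast
    show "monomial_code a \<le> monomial_code m" if "lookup h a \<notin> q" for a
      using that keys[of a] unfolding m(2)[symmetric] by (intro Max_ge) auto
  qed
qed

text \<open>As for Gauss's lemma, take the leading monomials \<open>m\<close> and \<open>m'\<close> of \<open>g\<close> and \<open>h\<close> modulo \<open>q\<close>: modulo
  \<open>q\<close>, the coefficient of \<open>g h\<close> at \<open>m + m'\<close> is the product of the two leading coefficients.\<close>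

lemma primeideal_coeff_extension:
  fixes q :: "'a::comm_ring_1 set"
  assumes q: "primeideal q ring_of_type_algebra"
  shows "primeideal (coeff_extension q :: ('n::finite, 'a) mpoly set) ring_of_type_algebra"
  unfolding primeideal_ring_of_type_algebra_iff
proof (intro conjI allI impI)
  have qi: "ideal q ring_of_type_algebra" and one: "1 \<notin> q"
    and prime: "\<And>a b. a * b \<in> q \<Longrightarrow> a \<in> q \<or> b \<in> q"
    using q unfolding primeideal_ring_of_type_algebra_iff by blast+
  have q0: "0 \<in> q" and add: "\<And>a b. a \<in> q \<Longrightarrow> b \<in> q \<Longrightarrow> a + b \<in> q"
    and mult: "\<And>r a. a \<in> q \<Longrightarrow> r * a \<in> q"
    using qi unfolding ideal_ring_of_type_algebra_iff by blast+
  have multr: "\<And>r a. a \<in> q \<Longrightarrow> a * r \<in> q" using mult by (metis mult.commute)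
  have cancel: "a \<in> q" if "a + b \<in> q" "b \<in> q" for a b
    using add[OF that(1) mult[OF that(2), of "-1"]] by simp
  show "ideal (coeff_extension q :: ('n, 'a) mpoly set) ring_of_type_algebra"
    by (rule ideal_coeff_extension[OF qi])
  show "(1 :: ('n, 'a) mpoly) \<notin> coeff_extension q"
    using one lookup_one[of 0] by (auto simp: coeff_extension_def intro!: exI[of _ 0])
  fix g h :: "('n, 'a) mpoly"
  assume gh: "g * h \<in> coeff_extension q"
  show "g \<in> coeff_extension q \<or> h \<in> coeff_extension q"
  proof (rule ccontr)
    assume "\<not> (g \<in> coeff_extension q \<or> h \<in> coeff_extension q)"
    then have ng: "g \<notin> coeff_extension q" and nh: "h \<notin> coeff_extension q" by auto
    obtain m where m: "lookup g m \<notin> q"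
      "\<And>a. lookup g a \<notin> q \<Longrightarrow> monomial_code a \<le> monomial_code m"
      using obtain_leading_monomial[OF ng q0] by blast
    obtain m' where m': "lookup h m' \<notin> q"
      "\<And>a. lookup h a \<notin> q \<Longrightarrow> monomial_code a \<le> monomial_code m'"
      using obtain_leading_monomial[OF nh q0] by blast
    let ?t = "\<lambda>(a, b). lookup g a * lookup h b when a + b = m + m'"
    let ?K = "keys g \<times> keys h"
    have mk: "(m, m') \<in> ?K" using m(1) m'(1) q0 by (auto simp: in_keys_iff)
    \<comment> \<open>if \<open>a + b = m + m'\<close> and \<open>a\<close> lies above \<open>m\<close> or \<open>b\<close> above \<open>m'\<close>, the term is in \<open>q\<close> by the
      choice of the leading monomials\<close>
    have rest: "?t x \<in> q" if "x \<in> ?K - {(m, m')}" for x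
    proof -
      obtain a b where x: "x = (a, b)" by (cases x)
      have "lookup g a \<in> q \<or> lookup h b \<in> q" if eq: "a + b = m + m'"
      proof (rule ccontr)
        assume "\<not> (lookup g a \<in> q \<or> lookup h b \<in> q)"
        then have le: "monomial_code a \<le> monomial_code m" "monomial_code b \<le> monomial_code m'"
          using m(2) m'(2) by auto
        have "monomial_code a + monomial_code b = monomial_code m + monomial_code m'"
          using eq by (simp flip: monomial_code_add)
        then have "monomial_code a = monomial_code m"
          using le add_less_le_mono[of "monomial_code a" "monomial_code m"]
          by (metis less_irrefl order_le_less)
        then have "a = m" by (simp add: monomial_code_eq_iff)
        then show False using eq that x \<open>x \<in> ?K - {(m, m')}\<close> by simp
      qed
      then show ?thesis using mult multr q0 x by (auto simp: when_def)
    qed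
    have split: "lookup (g * h) (m + m') = ?t (m, m') + sum ?t (?K - {(m, m')})"
      unfolding lookup_mult_keys by (rule sum.remove[OF _ mk]) simp
    have "lookup (g * h) (m + m') \<in> q" using gh by (simp add: coeff_extension_def)
    then have "?t (m, m') + sum ?t (?K - {(m, m')}) \<in> q" by (simp only: split)
    moreover have "sum ?t (?K - {(m, m')}) \<in> q" by (rule ideal_sum_closed[OF qi rest])
    ultimately have "?t (m, m') \<in> q" by (rule cancel)
    then have "lookup g m * lookup h m' \<in> q" by simp
    then show False using prime m(1) m'(1) by blast
  qed
qed

text \<open>In a domain the zero ideal is prime, and so is its extension, the zero ideal again.\<close>

lemma mpoly_no_zero_divisors:
  fixes g h :: "('n::finite, 'a::idom) mpoly"
  assumes "g * h = 0"
  shows "g = 0 \<or> h = 0"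
proof -
  have "primeideal {0 :: 'a} ring_of_type_algebra"
    by (auto simp: primeideal_ring_of_type_algebra_iff ideal_ring_of_type_algebra_iff)
  from primeideal_coeff_extension[OF this]
  have "primeideal (coeff_extension {0} :: ('n, 'a) mpoly set) ring_of_type_algebra" .
  moreover have "coeff_extension {0} = {0 :: ('n, 'a) mpoly}"
    by (auto simp: coeff_extension_def intro: poly_mapping_eqI)
  ultimately show ?thesis
    using assms by (simp add: primeideal_ring_of_type_algebra_iff)
qed

section \<open>Eliminating one variable by the forcing equation\<close>

definition free_of :: "'n \<Rightarrow> ('n, 'a::zero) mpoly \<Rightarrow> bool" where
  "free_of i h \<longleftrightarrow> (\<forall>m\<in>keys h. lookup m i = 0)"

lemma free_of_const [simp]: "free_of i (mpoly_const c)"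
  by (auto simp: free_of_def mpoly_const_def)

lemma free_of_var: "j \<noteq> i \<Longrightarrow> free_of i (mpoly_var j :: ('n, 'a::comm_ring_1) mpoly)"
  by (auto simp: free_of_def mpoly_var_def lookup_single when_def)

lemma free_of_add:
  assumes "free_of i g" "free_of i h"
  shows "free_of i (g + h)"
  unfolding free_of_def
proof
  fix m assume "m \<in> keys (g + h)"
  then have "m \<in> keys g \<union> keys h" using Poly_Mapping.keys_add[of g h] by (rule rev_subsetD)
  then show "lookup m i = 0" using assms by (auto simp: free_of_def)
qed

lemma free_of_mult:
  fixes g h :: "('n, 'a::comm_ring_1) mpoly"
  assumes "free_of i g" "free_of i h"
  shows "free_of i (g * h)"
  unfolding free_of_def
proof
  fix m assume "m \<in> keys (g * h)"
  then obtain a b where "m = a + b" "a \<in> keys g" "b \<in> keys h" using keys_mult by blast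
  then show "lookup m i = 0" using assms by (simp add: free_of_def lookup_add)
qed

lemma free_of_minus: "free_of i h \<Longrightarrow> free_of i (- h)"
  for h :: "('n, 'a::comm_ring_1) mpoly"
  by (simp add: free_of_def in_keys_iff)

lemma free_of_sum: "(\<And>x. x \<in> A \<Longrightarrow> free_of i (h x)) \<Longrightarrow> free_of i (sum h A)"
  for h :: "'b \<Rightarrow> ('n, 'a::comm_ring_1) mpoly"
  by (induction A rule: infinite_finite_induct) (auto simp: free_of_add, auto simp: free_of_def)

lemma forcing_polynomial_split:
  fixes fs :: "'n::finite \<Rightarrow> 'a::comm_ring_1"
  obtains s where "free_of i s"
    "forcing_polynomial fs f = mpoly_const (fs i) * mpoly_var i + s"
proof
  let ?s = "(\<Sum>j\<in>UNIV - {i}. mpoly_const (fs j) * mpoly_var j) + mpoly_const f"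
  show "free_of i ?s"
    by (intro free_of_add free_of_sum free_of_mult free_of_var) auto
  show "forcing_polynomial fs f = mpoly_const (fs i) * mpoly_var i + ?s"
    unfolding forcing_polynomial_def by (subst sum.remove[of _ i]) (auto simp: add.assoc)
qed

text \<open>Modulo the forcing polynomial \<open>g\<close>, the product \<open>f\<^sub>i T\<^sub>i\<close> is a polynomial in the other
  variables, so each factor \<open>T\<^sub>i\<close> can be eliminated at the cost of one factor \<open>f\<^sub>i\<close>.\<close>

lemma pseudo_division_by_forcing_polynomial:
  fixes fs :: "'n::finite \<Rightarrow> 'a::comm_ring_1" and h :: "('n, 'a) mpoly"
  shows "\<exists>k r u. free_of i r \<and> mpoly_const (fs i ^ k) * h = r + u * forcing_polynomial fs f"
proof (induction h rule: update_induct)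
  case const
  have "free_of i 0 \<and>
      mpoly_const (fs i ^ 0) * 0 = 0 + (0 :: ('n, 'a) mpoly) * forcing_polynomial fs f"
    by (simp add: free_of_def)
  then show ?case by blast
next
  case (update h m c)
  let ?g = "forcing_polynomial fs f"
  obtain s where s: "free_of i s" "?g = mpoly_const (fs i) * mpoly_var i + s"
    by (rule forcing_polynomial_split)
  have "\<exists>k r u. free_of i r \<and> mpoly_const (fs i ^ k) * Poly_Mapping.single m c = r + u * ?g"
  proof (induction "lookup m i" arbitrary: m)
    case 0
    then have "free_of i (Poly_Mapping.single m c) \<and>
      mpoly_const (fs i ^ 0) * Poly_Mapping.single m c = Poly_Mapping.single m c + 0 * ?g"
      by (simp add: free_of_def)
    then show ?case by blast
  next
    case (Suc n)
    define m' where "m' = m - Poly_Mapping.single i 1"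
    have m: "m = m' + Poly_Mapping.single i 1"
    proof (rule poly_mapping_eqI)
      fix j show "lookup m j = lookup (m' + Poly_Mapping.single i 1) j"
        using Suc(2) by (auto simp: m'_def lookup_minus lookup_add lookup_single when_def)
    qed
    then have "n = lookup m' i" using Suc(2) by (simp add: lookup_add)
    then obtain k r u where kru: "free_of i r"
      "mpoly_const (fs i ^ k) * Poly_Mapping.single m' c = r + u * ?g"
      using Suc(1) by blast
    have "Poly_Mapping.single m c = Poly_Mapping.single m' c * mpoly_var i"
      by (simp add: m mpoly_var_def mult_single)
    then have "mpoly_const (fs i ^ Suc k) * Poly_Mapping.single m c
        = (mpoly_const (fs i ^ k) * Poly_Mapping.single m' c) * (mpoly_const (fs i) * mpoly_var i)"
      by (simp add: mpoly_const_mult ac_simps)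
    also have "\<dots> = (r + u * ?g) * (?g - s)"
      unfolding kru(2) by (simp add: s(2))
    also have "\<dots> = - (r * s) + (r + u * ?g - u * s) * ?g"
      by (simp add: algebra_simps)
    finally show ?case using free_of_minus[OF free_of_mult[OF kru(1) s(1)]] by blast
  qed
  then obtain k r u where 1: "free_of i r"
    "mpoly_const (fs i ^ k) * Poly_Mapping.single m c = r + u * ?g" by blast
  from update(3) obtain l r' u' where 2: "free_of i r'"
    "mpoly_const (fs i ^ l) * h = r' + u' * ?g" by blast
  have "Poly_Mapping.update m c h = h + Poly_Mapping.single m c"
    using update(1)
    by (intro poly_mapping_eqI) (auto simp: lookup_update lookup_add lookup_single when_def in_keys_iff)
  then have "mpoly_const (fs i ^ (k + l)) * Poly_Mapping.update m c h
      = mpoly_const (fs i ^ k) * (mpoly_const (fs i ^ l) * h)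
        + mpoly_const (fs i ^ l) * (mpoly_const (fs i ^ k) * Poly_Mapping.single m c)"
    by (simp add: power_add mpoly_const_mult algebra_simps)
  also have "\<dots> = (mpoly_const (fs i ^ k) * r' + mpoly_const (fs i ^ l) * r)
      + (mpoly_const (fs i ^ k) * u' + mpoly_const (fs i ^ l) * u) * ?g"
    unfolding 1 2 by (simp add: algebra_simps)
  finally have eq: "mpoly_const (fs i ^ (k + l)) * Poly_Mapping.update m c h = \<dots>" .
  have "free_of i (mpoly_const (fs i ^ k) * r' + mpoly_const (fs i ^ l) * r)"
    by (intro free_of_add free_of_mult free_of_const 1(1) 2(1))
  then show ?case using eq by (intro exI conjI)
qed

text \<open>Multiplication by the forcing polynomial \<open>g\<close> raises the degree in \<open>T\<^sub>i\<close>: if \<open>m\<close> is a monomial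
  of \<open>u\<close> of largest degree in \<open>T\<^sub>i\<close>, with coefficient \<open>c\<close>, then \<open>m T\<^sub>i\<close> occurs in \<open>u g\<close> with
  coefficient \<open>f\<^sub>i c \<noteq> 0\<close>.\<close>

lemma free_of_multiple_of_forcing_polynomial:
  fixes fs :: "'n::finite \<Rightarrow> 'a::idom"
  assumes i: "fs i \<noteq> 0" and free: "free_of i (u * forcing_polynomial fs f)"
  shows "u = 0"
proof (rule ccontr)
  assume "u \<noteq> 0"
  then have ne: "keys u \<noteq> {}" by simp
  define d where "d = Max ((\<lambda>m. lookup m i) ` keys u)"
  have "d \<in> (\<lambda>m. lookup m i) ` keys u" unfolding d_def using ne by (intro Max_in) auto
  then obtain m where m: "m \<in> keys u" "lookup m i = d" by blast
  have max: "lookup a i \<le> d" if "a \<in> keys u" for a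
    unfolding d_def using that by (intro Max_ge) auto
  obtain s where s: "free_of i s"
    "forcing_polynomial fs f = mpoly_const (fs i) * mpoly_var i + s"
    by (rule forcing_polynomial_split)
  let ?e = "Poly_Mapping.single i 1 :: 'n \<Rightarrow>\<^sub>0 nat"
  have "lookup (u * s) (m + ?e) = 0"
  proof (rule ccontr)
    assume "lookup (u * s) (m + ?e) \<noteq> 0"
    then obtain a b where ab: "m + ?e = a + b" "a \<in> keys u" "b \<in> keys s"
      using keys_mult[of u s] by (auto simp: in_keys_iff)
    then have "lookup (m + ?e) i = lookup a i + lookup b i" by (simp add: lookup_add)
    then show False using ab(3) s(1) max[OF ab(2)] m(2)
      by (simp add: free_of_def lookup_add)
  qed
  moreover have "lookup (u * mpoly_var i) (m + ?e) = lookup u m"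
  proof -
    have "lookup (u * mpoly_var i) (m + ?e)
        = (\<Sum>(a, b)\<in>keys u \<times> {?e}. (lookup u a * lookup (mpoly_var i) b when a + b = m + ?e))"
      unfolding lookup_mult_keys by (simp add: mpoly_var_def)
    also have "\<dots> = (\<Sum>a\<in>keys u. \<Sum>b\<in>{?e}. (lookup u a * lookup (mpoly_var i) b when a + b = m + ?e))"
      by (rule sum.cartesian_product[symmetric])
    also have "\<dots> = (\<Sum>a\<in>keys u. if a = m then lookup u a else 0)"
      by (intro sum.cong) (auto simp: mpoly_var_def when_def)
    also have "\<dots> = lookup u m" using m(1) by simp
    finally show ?thesis .
  qed
  moreover have "u * forcing_polynomial fs f
      = mpoly_const (fs i) * (u * mpoly_var i) + u * s"
    by (simp add: s(2) algebra_simps)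
  ultimately have "lookup (u * forcing_polynomial fs f) (m + ?e) = fs i * lookup u m"
    by (simp add: lookup_add lookup_const_mult)
  then have "m + ?e \<in> keys (u * forcing_polynomial fs f)"
    using i m(1) by (simp add: in_keys_iff)
  then have "lookup (m + ?e) i = 0" using free by (simp add: free_of_def)
  then show False by (simp add: lookup_add)
qed

section \<open>The horizontal prime\<close>

text \<open>Clearing denominators, this is the contraction to \<open>R[T\<^sub>1, \<dots>, T\<^sub>n]\<close> of the ideal that the
  forcing polynomial generates over the quotient field.\<close>

definition horizontal_ideal :: "('n::finite \<Rightarrow> 'a::comm_ring_1) \<Rightarrow> 'a \<Rightarrow> ('n, 'a) mpoly set" where
  "horizontal_ideal fs f =
    {h. \<exists>d u. d \<noteq> 0 \<and> mpoly_const d * h = u * forcing_polynomial fs f}"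

lemma horizontal_idealI:
  "d \<noteq> 0 \<Longrightarrow> mpoly_const d * h = u * forcing_polynomial fs f \<Longrightarrow> h \<in> horizontal_ideal fs f"
  unfolding horizontal_ideal_def by blast

lemma multiple_in_horizontal_ideal: "u * forcing_polynomial fs f \<in> horizontal_ideal fs f"
  by (rule horizontal_idealI[of 1]) auto

lemma ideal_horizontal_ideal:
  fixes fs :: "'n::finite \<Rightarrow> 'a::idom"
  shows "ideal (horizontal_ideal fs f) ring_of_type_algebra"
  unfolding ideal_ring_of_type_algebra_iff
proof (intro conjI ballI allI)
  show "0 \<in> horizontal_ideal fs f" using multiple_in_horizontal_ideal[of 0] by simp
  fix h assume "h \<in> horizontal_ideal fs f"
  then obtain d u where du: "d \<noteq> 0" "mpoly_const d * h = u * forcing_polynomial fs f"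
    unfolding horizontal_ideal_def by blast
  show "r * h \<in> horizontal_ideal fs f" for r
  proof (rule horizontal_idealI[OF du(1)])
    have "mpoly_const d * (r * h) = r * (mpoly_const d * h)" by (rule mult.left_commute)
    then show "mpoly_const d * (r * h) = (r * u) * forcing_polynomial fs f"
      by (simp only: du(2) mult.assoc)
  qed
  fix h' assume "h' \<in> horizontal_ideal fs f"
  then obtain d' u' where du': "d' \<noteq> 0" "mpoly_const d' * h' = u' * forcing_polynomial fs f"
    unfolding horizontal_ideal_def by blast
  show "h + h' \<in> horizontal_ideal fs f"
  proof (rule horizontal_idealI)
    show "d * d' \<noteq> 0" using du du' by simp
    have "mpoly_const (d * d') * (h + h')
        = mpoly_const d' * (mpoly_const d * h) + mpoly_const d * (mpoly_const d' * h')"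
      by (simp add: mpoly_const_mult algebra_simps)
    also have "\<dots> = (mpoly_const d' * u + mpoly_const d * u') * forcing_polynomial fs f"
      unfolding du(2) du'(2) by (simp add: algebra_simps)
    finally show "mpoly_const (d * d') * (h + h')
        = (mpoly_const d' * u + mpoly_const d * u') * forcing_polynomial fs f" .
  qed
qed

lemma const_in_horizontal_ideal_iff:
  fixes fs :: "'n::finite \<Rightarrow> 'a::idom"
  assumes "fs i \<noteq> 0"
  shows "mpoly_const c \<in> horizontal_ideal fs f \<longleftrightarrow> c = 0"
proof
  assume "mpoly_const c \<in> horizontal_ideal fs f"
  then obtain d u where du: "d \<noteq> 0"
    "(mpoly_const (d * c) :: ('n, 'a) mpoly) = u * forcing_polynomial fs f"
    unfolding horizontal_ideal_def mpoly_const_mult by blast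
  then have "u = 0"
    using free_of_multiple_of_forcing_polynomial[of fs i u f] assms by (metis free_of_const)
  then show "c = 0" using du by simp
qed (use ideal_horizontal_ideal[of fs f] in \<open>auto simp: ideal_ring_of_type_algebra_iff\<close>)

text \<open>After multiplication by powers of \<open>f\<^sub>i\<close>, two polynomials \<open>h, h'\<close> are congruent modulo the forcing
  polynomial \<open>g\<close> to polynomials \<open>r, r'\<close> free of \<open>T\<^sub>i\<close>. If \<open>h h'\<close> lies in the horizontal ideal, then
  some \<open>d r r'\<close> with \<open>d \<noteq> 0\<close> is a multiple of \<open>g\<close> free of \<open>T\<^sub>i\<close>, hence zero, and so \<open>r\<close> or \<open>r'\<close>
  vanishes.\<close>

lemma primeideal_horizontal_ideal:
  fixes fs :: "'n::finite \<Rightarrow> 'a::idom"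
  assumes i: "fs i \<noteq> 0"
  shows "primeideal (horizontal_ideal fs f) ring_of_type_algebra"
  unfolding primeideal_ring_of_type_algebra_iff
proof (intro conjI allI impI)
  let ?g = "forcing_polynomial fs f"
  show "ideal (horizontal_ideal fs f) ring_of_type_algebra" by (rule ideal_horizontal_ideal)
  show "1 \<notin> horizontal_ideal fs f"
    using const_in_horizontal_ideal_iff[of fs i 1 f] i by simp
  fix h h' assume "h * h' \<in> horizontal_ideal fs f"
  then obtain d v where d: "d \<noteq> 0" "mpoly_const d * (h * h') = v * ?g"
    unfolding horizontal_ideal_def by blast
  obtain k r u where h: "free_of i r" "mpoly_const (fs i ^ k) * h = r + u * ?g"
    using pseudo_division_by_forcing_polynomial by metis
  obtain l r' u' where h': "free_of i r'" "mpoly_const (fs i ^ l) * h' = r' + u' * ?g"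
    using pseudo_division_by_forcing_polynomial by metis
  \<comment> \<open>\<open>w\<close> is the cofactor of \<open>g\<close> in \<open>d r r'\<close>\<close>
  define w where "w = mpoly_const (fs i ^ k) * mpoly_const (fs i ^ l) * v
      - mpoly_const d * (r * u' + u * r' + u * u' * ?g)"
  have "mpoly_const d * (r + u * ?g) * (r' + u' * ?g)
      = mpoly_const (fs i ^ k) * mpoly_const (fs i ^ l) * (mpoly_const d * (h * h'))"
    unfolding h(2)[symmetric] h'(2)[symmetric] by (simp add: algebra_simps)
  then have rr: "mpoly_const d * (r * r') = w * ?g"
    unfolding w_def d(2) by (simp add: algebra_simps)
  have "free_of i (w * ?g)"
    unfolding rr[symmetric] using h(1) h'(1) by (intro free_of_mult) auto
  then have "w = 0" using free_of_multiple_of_forcing_polynomial[where fs = fs and i = i, OF i] by blast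
  then have "mpoly_const d * (r * r') = 0" using rr by simp
  then have "r = 0 \<or> r' = 0" using mpoly_no_zero_divisors d(1) by (metis mpoly_const_eq_0_iff)
  then have "mpoly_const (fs i ^ k) * h = u * ?g \<or> mpoly_const (fs i ^ l) * h' = u' * ?g"
    using h h' by auto
  then show "h \<in> horizontal_ideal fs f \<or> h' \<in> horizontal_ideal fs f"
    using horizontal_idealI[of "fs i ^ k" h u fs f] horizontal_idealI[of "fs i ^ l" h' u' fs f] i
    by auto
qed

text \<open>Elimination of \<open>T\<^sub>j\<close> turns the denominator \<open>d\<close> in the definition of the horizontal ideal into
  a power of \<open>f\<^sub>j\<close>, which can be cancelled modulo a prime that avoids \<open>f\<^sub>j\<close>.\<close>

lemma horizontal_ideal_subset_prime:
  fixes fs :: "'n::finite \<Rightarrow> 'a::idom"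
  assumes P: "primeideal P ring_of_type_algebra"
    and g: "forcing_polynomial fs f \<in> P" and j: "mpoly_const (fs j) \<notin> P"
  shows "horizontal_ideal fs f \<subseteq> P"
proof
  let ?g = "forcing_polynomial fs f"
  have Pi: "0 \<in> P" "\<And>r a. a \<in> P \<Longrightarrow> r * a \<in> P" "1 \<notin> P"
    and prime: "\<And>a b. a * b \<in> P \<Longrightarrow> a \<in> P \<or> b \<in> P"
    using P unfolding primeideal_ring_of_type_algebra_iff ideal_ring_of_type_algebra_iff by blast+
  have "fs j \<noteq> 0" using j Pi(1) by auto
  fix h assume "h \<in> horizontal_ideal fs f"
  then obtain d v where d: "d \<noteq> 0" "mpoly_const d * h = v * ?g"
    unfolding horizontal_ideal_def by blast
  obtain k r u where h: "free_of j r" "mpoly_const (fs j ^ k) * h = r + u * ?g"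
    using pseudo_division_by_forcing_polynomial by metis
  have "mpoly_const d * (r + u * ?g) = mpoly_const (fs j ^ k) * (mpoly_const d * h)"
    unfolding h(2)[symmetric] by (simp add: algebra_simps)
  then have r: "mpoly_const d * r = (mpoly_const (fs j ^ k) * v - mpoly_const d * u) * ?g"
    unfolding d(2) by (simp add: algebra_simps)
  have "mpoly_const d * r = 0"
    using free_of_multiple_of_forcing_polynomial[where fs = fs and i = j, OF \<open>fs j \<noteq> 0\<close>]
      free_of_mult[OF free_of_const h(1)] r by (metis mult_zero_left)
  then have "r = 0" using mpoly_no_zero_divisors d(1) by (metis mpoly_const_eq_0_iff)
  then have "mpoly_const (fs j ^ k) * h \<in> P" using h(2) Pi(2)[OF g] by simp
  moreover have "mpoly_const (fs j ^ k) \<notin> P"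
  proof (induction k)
    case 0
    then show ?case using Pi(3) by simp
  next
    case (Suc k)
    then show ?case using prime j by (auto simp: mpoly_const_mult)
  qed
  ultimately show "h \<in> P" using prime by blast
qed

lemma forcing_polynomial_in_ideal_iff:
  fixes fs :: "'n::finite \<Rightarrow> 'a::comm_ring_1"
  assumes I: "ideal I ring_of_type_algebra" and "\<And>i. mpoly_const (fs i) \<in> I"
  shows "forcing_polynomial fs f \<in> I \<longleftrightarrow> mpoly_const f \<in> I"
proof -
  have I': "\<And>a b. a \<in> I \<Longrightarrow> b \<in> I \<Longrightarrow> a + b \<in> I" "\<And>r a. a \<in> I \<Longrightarrow> r * a \<in> I"
    using I unfolding ideal_ring_of_type_algebra_iff by blast+
  let ?s = "\<Sum>i\<in>UNIV. mpoly_const (fs i) * mpoly_var i :: ('n, 'a) mpoly"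
  have s: "?s \<in> I"
  proof (rule ideal_sum_closed[OF I])
    fix i
    have "mpoly_var i * mpoly_const (fs i) \<in> I" using I'(2) assms(2) by blast
    then show "mpoly_const (fs i) * mpoly_var i \<in> I" by (simp only: mult.commute)
  qed
  have g: "forcing_polynomial fs f = ?s + mpoly_const f" by (simp add: forcing_polynomial_def)
  show ?thesis
  proof
    assume "forcing_polynomial fs f \<in> I"
    then have "forcing_polynomial fs f + (-1) * ?s \<in> I" using I' s by blast
    then show "mpoly_const f \<in> I" by (simp add: g)
  next
    assume "mpoly_const f \<in> I"
    then show "forcing_polynomial fs f \<in> I" unfolding g by (rule I'(1)[OF s])
  qed
qed

section \<open>The irreducible components of the spectrum of a forcing algebra\<close>

lemma forcing_ideal_eq: "forcing_ideal fs f = {u * forcing_polynomial fs f | u. True}"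
  unfolding forcing_ideal_def by (rule genideal_singleton_ring_of_type_algebra)

lemma forcing_polynomial_in_forcing_ideal: "forcing_polynomial fs f \<in> forcing_ideal fs f"
  unfolding forcing_ideal_eq by (auto intro: exI[of _ 1])

lemma ideal_forcing_ideal: "ideal (forcing_ideal fs f) ring_of_type_algebra"
proof -
  interpret R: cring "ring_of_type_algebra :: ('a, 'b) mpoly ring"
    by (rule cring_from_type_algebra)
  show ?thesis unfolding forcing_ideal_def by (rule R.genideal_ideal) simp
qed

lemma forcing_ideal_subset_iff:
  assumes "ideal P ring_of_type_algebra"
  shows "forcing_ideal fs f \<subseteq> P \<longleftrightarrow> forcing_polynomial fs f \<in> P"
  using assms forcing_polynomial_in_forcing_ideal
  unfolding ideal_ring_of_type_algebra_iff forcing_ideal_eq by blast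

abbreviation forcing_quotient_map ::
    "('n::finite \<Rightarrow> 'a::comm_ring_1) \<Rightarrow> 'a \<Rightarrow> ('n, 'a) mpoly \<Rightarrow> ('n, 'a) mpoly set" where
  "forcing_quotient_map fs f \<equiv> (+>\<^bsub>ring_of_type_algebra\<^esub>) (forcing_ideal fs f)"

text \<open>For an ideal \<open>P\<close> of the polynomial ring, this is the closed set \<open>V(P)\<close>
  viewed inside the spectrum of the forcing algebra.\<close>

definition forcing_locus ::
    "('n::finite \<Rightarrow> 'a::comm_ring_1) \<Rightarrow> 'a \<Rightarrow> ('n, 'a) mpoly set \<Rightarrow> ('n, 'a) mpoly set set set" where
  "forcing_locus fs f P = zero_locus (forcing_algebra fs f) (forcing_quotient_map fs f ` P)"

lemma forcing_quotient_hom: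
  "ring_hom_ring ring_of_type_algebra (forcing_algebra fs f) (forcing_quotient_map fs f)"
  unfolding forcing_algebra_def by (rule ideal.rcos_ring_hom_ring[OF ideal_forcing_ideal])

lemma primeideal_forcing_preimage:
  assumes "primeideal Q (forcing_algebra fs f)"
  shows "primeideal {h. forcing_quotient_map fs f h \<in> Q} ring_of_type_algebra"
    and "forcing_polynomial fs f \<in> {h. forcing_quotient_map fs f h \<in> Q}"
proof -
  interpret h: ring_hom_ring ring_of_type_algebra "forcing_algebra fs f" "forcing_quotient_map fs f"
    by (rule forcing_quotient_hom)
  interpret I: ideal "forcing_ideal fs f" ring_of_type_algebra by (rule ideal_forcing_ideal)
  show pre: "primeideal {h. forcing_quotient_map fs f h \<in> Q} ring_of_type_algebra"
    using h.primeideal_vimage[OF cring_from_type_algebra assms] by simp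
  have "forcing_quotient_map fs f (forcing_polynomial fs f) = forcing_quotient_map fs f 0"
    using I.a_rcos_const[OF forcing_polynomial_in_forcing_ideal]
      I.a_rcos_const[of 0] I.zero_closed by simp
  moreover have "0 \<in> {h. forcing_quotient_map fs f h \<in> Q}"
    using pre unfolding primeideal_ring_of_type_algebra_iff ideal_ring_of_type_algebra_iff by blast
  ultimately show "forcing_polynomial fs f \<in> {h. forcing_quotient_map fs f h \<in> Q}" by simp
qed

lemma forcing_locus_closed_irreducible:
  assumes P: "primeideal P ring_of_type_algebra" and g: "forcing_polynomial fs f \<in> P"
  shows "closedin (Spec (forcing_algebra fs f)) (forcing_locus fs f P)"
    and "irreducible_space (subtopology (Spec (forcing_algebra fs f)) (forcing_locus fs f P))"
    and "forcing_quotient_map fs f ` P \<in> forcing_locus fs f P"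
    and "forcing_quotient_map fs f h \<in> forcing_quotient_map fs f ` P \<longleftrightarrow> h \<in> P"
proof -
  interpret I: ideal "forcing_ideal fs f" ring_of_type_algebra by (rule ideal_forcing_ideal)
  have Pi: "ideal P ring_of_type_algebra" using P by (rule primeideal.axioms(1))
  then have sub: "forcing_ideal fs f \<subseteq> P" using g forcing_ideal_subset_iff by blast
  have prime: "primeideal (forcing_quotient_map fs f ` P) (forcing_algebra fs f)"
    unfolding forcing_algebra_def by (rule I.rcos_image_prime[OF P sub])
  show "irreducible_space (subtopology (Spec (forcing_algebra fs f)) (forcing_locus fs f P))"
    unfolding forcing_locus_def by (rule irreducible_zero_locus_prime[OF prime])
  show "forcing_quotient_map fs f ` P \<in> forcing_locus fs f P"
    using prime by (simp add: forcing_locus_def zero_locus_def)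
  show "forcing_quotient_map fs f h \<in> forcing_quotient_map fs f ` P \<longleftrightarrow> h \<in> P"
    by (rule I.rcos_in_image_iff[OF Pi sub]) simp
  interpret J: primeideal "forcing_quotient_map fs f ` P" "forcing_algebra fs f" by (rule prime)
  show "closedin (Spec (forcing_algebra fs f)) (forcing_locus fs f P)"
    unfolding closedin_Spec forcing_locus_def using J.a_subset by blast
qed

lemma mem_forcing_locus_iff:
  assumes "primeideal Q (forcing_algebra fs f)"
  shows "Q \<in> forcing_locus fs f P \<longleftrightarrow> P \<subseteq> {h. forcing_quotient_map fs f h \<in> Q}"
  using assms by (auto simp: forcing_locus_def zero_locus_def)

lemma primeideal_const_contraction:
  fixes P :: "('n, 'a::comm_ring_1) mpoly set"
  assumes P: "primeideal P ring_of_type_algebra"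
  shows "primeideal {c. mpoly_const c \<in> P} ring_of_type_algebra"
proof -
  have P': "0 \<in> P" "\<And>a b. a \<in> P \<Longrightarrow> b \<in> P \<Longrightarrow> a + b \<in> P" "\<And>r a. a \<in> P \<Longrightarrow> r * a \<in> P"
    "1 \<notin> P" "\<And>a b. a * b \<in> P \<Longrightarrow> a \<in> P \<or> b \<in> P"
    using P unfolding primeideal_ring_of_type_algebra_iff ideal_ring_of_type_algebra_iff by simp_all
  show ?thesis
    unfolding primeideal_ring_of_type_algebra_iff ideal_ring_of_type_algebra_iff
    using P' by (simp add: mpoly_const_add mpoly_const_mult)
qed

text \<open>A prime of the forcing algebra that avoids some \<open>f\<^sub>j\<close> contains the horizontal ideal. One that
  contains all \<open>f\<^sub>j\<close> also contains \<open>f\<close>, hence one of finitely many primes of \<open>R\<close> over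
  \<open>(f\<^sub>1, \<dots>, f\<^sub>n, f)\<close>, together with its extension to the polynomial ring.\<close>

lemma Spec_forcing_algebra_cover:
  fixes fs :: "'n::finite \<Rightarrow> 'a::idom"
  assumes noeth: "noetherian_domain (ring_of_type_algebra :: 'a ring)"
  obtains Q where "finite Q"
    "\<And>q. q \<in> Q \<Longrightarrow> primeideal q ring_of_type_algebra \<and> insert f (range fs) \<subseteq> q"
    "topspace (Spec (forcing_algebra fs f)) =
      forcing_locus fs f (horizontal_ideal fs f) \<union>
      (\<Union>q\<in>Q. forcing_locus fs f (coeff_extension q))"
proof -
  let ?R = "ring_of_type_algebra :: 'a ring"
  interpret R: noetherian_domain ?R by (rule noeth)
  have "insert f (range fs) \<subseteq> carrier ?R" by simp
  from R.finitely_many_primes_below_all[OF R.is_cring this]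
  obtain Q where Q: "finite Q"
    "\<And>q. q \<in> Q \<Longrightarrow> primeideal q ?R \<and> insert f (range fs) \<subseteq> q"
    "\<And>P. primeideal P ?R \<Longrightarrow> insert f (range fs) \<subseteq> P \<Longrightarrow> \<exists>q\<in>Q. q \<subseteq> P"
    by blast
  have "\<P> \<in> forcing_locus fs f (horizontal_ideal fs f) \<union>
      (\<Union>q\<in>Q. forcing_locus fs f (coeff_extension q))"
    if prime: "primeideal \<P> (forcing_algebra fs f)" for \<P>
  proof (cases "\<exists>j. mpoly_const (fs j) \<notin> {h. forcing_quotient_map fs f h \<in> \<P>}")
    let ?P = "{h. forcing_quotient_map fs f h \<in> \<P>}"
    case True
    then have "horizontal_ideal fs f \<subseteq> ?P"
      using horizontal_ideal_subset_prime[OF primeideal_forcing_preimage[OF prime]] by blast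
    then show ?thesis using mem_forcing_locus_iff[OF prime] by blast
  next
    let ?P = "{h. forcing_quotient_map fs f h \<in> \<P>}"
    case False
    then have fs: "mpoly_const (fs j) \<in> ?P" for j by blast
    have P: "primeideal ?P ring_of_type_algebra" by (rule primeideal_forcing_preimage[OF prime])
    then have Pi: "ideal ?P ring_of_type_algebra" by (rule primeideal.axioms(1))
    have "mpoly_const f \<in> ?P"
      by (rule iffD1[OF forcing_polynomial_in_ideal_iff[OF Pi fs] primeideal_forcing_preimage(2)[OF prime]])
    then have "insert f (range fs) \<subseteq> {c. mpoly_const c \<in> ?P}" using fs by auto
    from Q(3)[OF primeideal_const_contraction[OF P] this]
    obtain q where q: "q \<in> Q" "q \<subseteq> {c. mpoly_const c \<in> ?P}" by (rule bexE)
    then have "coeff_extension q \<subseteq> ?P" by (intro coeff_extension_subset[OF Pi]) auto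
    then show ?thesis using mem_forcing_locus_iff[OF prime] q(1) by blast
  qed
  moreover have "forcing_locus fs f P \<subseteq> {\<P>. primeideal \<P> (forcing_algebra fs f)}" for P
    by (auto simp: forcing_locus_def zero_locus_def)
  ultimately have "topspace (Spec (forcing_algebra fs f)) =
      forcing_locus fs f (horizontal_ideal fs f) \<union>
      (\<Union>q\<in>Q. forcing_locus fs f (coeff_extension q))"
    unfolding topspace_Spec by blast
  then show thesis using that Q(1,2) by blast
qed

text \<open>The generic point of the locus of \<open>P\<close> lies over \<open>P \<inter> R\<close>, and all its other points lie over
  primes containing \<open>P \<inter> R\<close>. So the closure of the image is \<open>V(P \<inter> R)\<close>, which is the whole spectrum
  of the domain \<open>R\<close> exactly when \<open>P \<inter> R\<close> is zero.\<close>

lemma image_forcing_locus_dense_iff: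
  fixes fs :: "'n::finite \<Rightarrow> 'a::idom"
  assumes P: "primeideal P ring_of_type_algebra" and g: "forcing_polynomial fs f \<in> P"
  shows "Spec (ring_of_type_algebra :: 'a ring) closure_of
      (Spec_map ring_of_type_algebra (forcing_structure_map fs f) ` forcing_locus fs f P)
      = topspace (Spec (ring_of_type_algebra :: 'a ring))
    \<longleftrightarrow> {c. mpoly_const c \<in> P} = {0}"
    (is "?S closure_of ?M = topspace ?S \<longleftrightarrow> ?c = {0}")
proof -
  let ?R = "ring_of_type_algebra :: 'a ring"
  note locus = forcing_locus_closed_irreducible[OF P g]
  have map: "Spec_map ?R (forcing_structure_map fs f) \<P> =
      {c. forcing_quotient_map fs f (mpoly_const c) \<in> \<P>}" for \<P>
    by (simp add: Spec_map_def forcing_structure_map_def)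
  have zero: "primeideal {0} ?R"
    by (auto simp: primeideal_ring_of_type_algebra_iff ideal_ring_of_type_algebra_iff)
  have c0: "0 \<in> ?c"
    using P unfolding primeideal_ring_of_type_algebra_iff ideal_ring_of_type_algebra_iff by simp
  have c: "?c \<in> ?M"
    using locus(3) unfolding map[symmetric]
    by (intro image_eqI[of _ _ "forcing_quotient_map fs f ` P"]) (auto simp: map locus(4))
  show ?thesis
  proof
    assume dense: "?S closure_of ?M = topspace ?S"
    have "?M \<subseteq> zero_locus ?R ?c"
    proof
      fix p assume "p \<in> ?M"
      then obtain \<P> where \<P>: "\<P> \<in> forcing_locus fs f P"
        "p = {c. forcing_quotient_map fs f (mpoly_const c) \<in> \<P>}" unfolding map by blast
      then have prime: "primeideal \<P> (forcing_algebra fs f)"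
        by (simp add: forcing_locus_def zero_locus_def)
      have "primeideal {h. forcing_quotient_map fs f h \<in> \<P>} ring_of_type_algebra"
        by (rule primeideal_forcing_preimage[OF prime])
      then have "primeideal p ?R"
        unfolding \<P>(2) using primeideal_const_contraction by fastforce
      then show "p \<in> zero_locus ?R ?c"
        using \<P> mem_forcing_locus_iff[OF prime, of P] by (auto simp: zero_locus_def)
    qed
    moreover have "closedin ?S (zero_locus ?R ?c)" unfolding closedin_Spec by auto
    ultimately have "?S closure_of ?M \<subseteq> zero_locus ?R ?c" by (rule closure_of_minimal)
    moreover have "{0} \<in> topspace ?S" using zero by (simp add: topspace_Spec)
    ultimately have "{0} \<in> zero_locus ?R ?c" using dense by blast
    then show "?c = {0}" using c0 by (auto simp: zero_locus_def)
  next
    assume "?c = {0}"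
    have "topspace ?S \<subseteq> C" if C: "closedin ?S C" "{0} \<in> C" for C
    proof -
      obtain B where B: "C = zero_locus ?R B" using C(1) unfolding closedin_Spec by blast
      then have "B \<subseteq> {0}" using C(2) by (simp add: zero_locus_def)
      moreover have "0 \<in> p" if "primeideal p ?R" for p
        using that unfolding primeideal_ring_of_type_algebra_iff ideal_ring_of_type_algebra_iff
        by blast
      ultimately show ?thesis unfolding B by (auto simp: topspace_Spec zero_locus_def)
    qed
    moreover have "{0} \<in> ?S closure_of ?M"
      using c \<open>?c = {0}\<close> zero unfolding in_closure_of by (auto simp: topspace_Spec)
    ultimately show "?S closure_of ?M = topspace ?S"
      using closedin_closure_of closure_of_subset_topspace by (metis subset_antisym)
  qed
qed

text \<open>The horizontal locus is the only member of the finite cover with dense image, since the other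
  members lie over primes \<open>q\<close> containing \<open>f\<^sub>i \<noteq> 0\<close>. Density passes to larger sets, so no other member
  contains it, and it is an irreducible component.\<close>

lemma horizontal_component_properties:
  fixes fs :: "'n::finite \<Rightarrow> 'a::idom" and f :: 'a
  assumes noeth: "noetherian_domain (ring_of_type_algebra :: 'a ring)" and i: "fs i \<noteq> 0"
  defines "S \<equiv> Spec (forcing_algebra fs f)"
  shows "horizontal_component fs f = forcing_locus fs f (horizontal_ideal fs f)"
    and "horizontal_component fs f \<in> irreducible_components_of S"
    and "finite (irreducible_components_of S)"
    and "\<Union>(irreducible_components_of S) = topspace S"
    and "\<And>C. C \<in> irreducible_components_of S \<Longrightarrow> closedin S C \<and> connectedin S C"
proof -
  let ?R = "ring_of_type_algebra :: 'a ring"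
  let ?H = "forcing_locus fs f (horizontal_ideal fs f)"
  let ?V = "\<lambda>q. forcing_locus fs f (coeff_extension q)"
  let ?dense = "\<lambda>C. Spec ?R closure_of (Spec_map ?R (forcing_structure_map fs f) ` C)
    = topspace (Spec ?R)"
  obtain Q where Q: "finite Q"
    "\<And>q. q \<in> Q \<Longrightarrow> primeideal q ring_of_type_algebra \<and> insert f (range fs) \<subseteq> q"
    and cov: "topspace (Spec (forcing_algebra fs f)) = ?H \<union> (\<Union>q\<in>Q. ?V q)"
    using Spec_forcing_algebra_cover[OF noeth, of f fs] by blast
  define \<F> where "\<F> = insert ?H (?V ` Q)"
  have H: "primeideal (horizontal_ideal fs f) ring_of_type_algebra"
    "forcing_polynomial fs f \<in> horizontal_ideal fs f"
    using primeideal_horizontal_ideal[where fs = fs and i = i, OF i] multiple_in_horizontal_ideal[of 1 fs f] by auto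
  have V: "primeideal (coeff_extension q :: ('n, 'a) mpoly set) ring_of_type_algebra"
    "forcing_polynomial fs f \<in> coeff_extension q"
    "mpoly_const (fs i) \<in> (coeff_extension q :: ('n, 'a) mpoly set)" if "q \<in> Q" for q
  proof -
    have q: "primeideal q ?R" "f \<in> q" "\<And>j. fs j \<in> q" "0 \<in> q"
      using Q(2)[OF that]
      by (auto simp: primeideal_ring_of_type_algebra_iff ideal_ring_of_type_algebra_iff)
    then show 1: "primeideal (coeff_extension q :: ('n, 'a) mpoly set) ring_of_type_algebra"
      using primeideal_coeff_extension by blast
    have const: "mpoly_const c \<in> (coeff_extension q :: ('n, 'a) mpoly set)" if "c \<in> q" for c
      using that q(4) by (simp add: coeff_extension_def lookup_const)
    then show "mpoly_const (fs i) \<in> (coeff_extension q :: ('n, 'a) mpoly set)" using q(3) by blast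
    show "forcing_polynomial fs f \<in> coeff_extension q"
      using forcing_polynomial_in_ideal_iff[OF primeideal.axioms(1)[OF 1]] const q by blast
  qed
  have F: "closedin S C \<and> irreducible_space (subtopology S C)" if "C \<in> \<F>" for C
    using that forcing_locus_closed_irreducible(1,2)[OF H]
      forcing_locus_closed_irreducible(1,2)[OF V(1,2)]
    unfolding \<F>_def S_def by blast
  have fin: "finite \<F>" using Q(1) by (simp add: \<F>_def)
  have cov': "\<Union>\<F> = topspace S" unfolding S_def cov \<F>_def by auto
  have comps: "irreducible_components_of S = {C \<in> \<F>. \<forall>D\<in>\<F>. C \<subseteq> D \<longrightarrow> D = C}"
    by (rule irreducible_components_of_finite_cover[OF fin F cov'])
  have Hdense: "?dense ?H"
    using image_forcing_locus_dense_iff[OF H] const_in_horizontal_ideal_iff[of fs i, OF i] by auto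
  have Vdense: "\<not> ?dense (?V q)" if "q \<in> Q" for q
    using image_forcing_locus_dense_iff[OF V(1,2)[OF that]] V(3)[OF that] i by auto
  have "\<not> ?H \<subseteq> ?V q" if "q \<in> Q" for q
  proof
    assume "?H \<subseteq> ?V q"
    then have "Spec ?R closure_of (Spec_map ?R (forcing_structure_map fs f) ` ?H)
        \<subseteq> Spec ?R closure_of (Spec_map ?R (forcing_structure_map fs f) ` ?V q)"
      by (intro closure_of_mono image_mono)
    then show False
      using Hdense Vdense[OF that] closure_of_subset_topspace by (metis subset_antisym)
  qed
  then have Hcomp: "?H \<in> irreducible_components_of S"
    unfolding comps by (auto simp: \<F>_def)
  show Heq: "horizontal_component fs f = ?H"
    unfolding horizontal_component_def
  proof (rule the_equality)
    show "?H \<in> irreducible_components_of (Spec (forcing_algebra fs f)) \<and> ?dense ?H"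
      using Hcomp Hdense unfolding S_def by blast
    fix C assume C: "C \<in> irreducible_components_of (Spec (forcing_algebra fs f)) \<and> ?dense C"
    then have "C \<in> \<F>" using comps unfolding S_def by blast
    then show "C = ?H" using C Vdense unfolding \<F>_def by blast
  qed
  show "horizontal_component fs f \<in> irreducible_components_of S" using Hcomp Heq by simp
  show "finite (irreducible_components_of S)" unfolding comps using fin by simp
  show "\<Union>(irreducible_components_of S) = topspace S"
    by (rule Union_irreducible_components_of_finite_cover[OF fin F cov'])
  fix C assume "C \<in> irreducible_components_of S"
  then have C: "closedin S C" "irreducible_space (subtopology S C)"
    using F[of C] unfolding comps by simp_all
  then show "closedin S C \<and> connectedin S C"
    using irreducible_imp_connectedin[OF closedin_subset[OF C(1)] C(2)] by simp
qed

theorem theorem3p1: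
  fixes fs :: "'n::finite \<Rightarrow> 'a::idom" and f :: 'a
  assumes "noetherian_domain (ring_of_type_algebra :: 'a ring)"
    and "Idl\<^bsub>ring_of_type_algebra\<^esub> (range fs) \<noteq> {0}"
  shows "nonempty_connected_space (Spec (forcing_algebra fs f)) \<longleftrightarrow>
    (\<forall>Z \<in> connected_components_of
            (subtopology (Spec (forcing_algebra fs f)) (\<Union>(vertical_components fs f))).
       horizontal_component fs f \<inter> Z \<noteq> {})"
proof -
  let ?S = "Spec (forcing_algebra fs f)" and ?H = "horizontal_component fs f"
  interpret R: noetherian_domain "ring_of_type_algebra :: 'a ring" by (rule assms(1))
  obtain i where i: "fs i \<noteq> 0"
  proof (rule ccontr)
    assume "\<not> thesis"
    then have "range fs \<subseteq> {0}" using that by auto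
    moreover have "ideal {0} (ring_of_type_algebra :: 'a ring)"
      by (simp add: ideal_ring_of_type_algebra_iff)
    ultimately have "Idl\<^bsub>ring_of_type_algebra\<^esub> (range fs) \<subseteq> {0}"
      by (intro R.genideal_minimal)
    moreover have "0 \<in> Idl\<^bsub>ring_of_type_algebra\<^esub> (range fs)"
      using R.genideal_ideal[of "range fs"] by (simp add: ideal_ring_of_type_algebra_iff)
    ultimately show False using assms(2) by blast
  qed
  note comps = horizontal_component_properties[where fs = fs and f = f and i = i, OF assms(1) i]
  have ne: "?H \<noteq> {}"
    using comps(2) unfolding irreducible_components_of_def irreducible_space_def by auto
  have un: "?H \<union> \<Union>(vertical_components fs f) = topspace ?S"
    using comps(2,4) unfolding vertical_components_def by blast
  have "connected_space ?S \<longleftrightarrow>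
    (\<forall>Z \<in> connected_components_of (subtopology ?S (\<Union>(vertical_components fs f))). ?H \<inter> Z \<noteq> {})"
  proof (rule connected_space_iff_meets_components[OF _ _ ne _ _ un])
    show "closedin ?S ?H" "connectedin ?S ?H" using comps(2,5) by blast+
    show "finite (vertical_components fs f)" using comps(3) by (simp add: vertical_components_def)
    show "closedin ?S C \<and> connectedin ?S C" if "C \<in> vertical_components fs f" for C
      using that comps(5) by (simp add: vertical_components_def)
  qed
  moreover have "topspace ?S \<noteq> {}" using ne un by blast
  ultimately show ?thesis unfolding nonempty_connected_space_def by blast
qed

end
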